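(* For every constant $C\ge 1$ there is a constant $c>0$ such that the following holds. For every number of cups $n$ and every $k$ with $1\le k\le Cn$, if the emptier follows the greedy emptying strategy in the negative-fill variable-processor cup game on $n$ cups (starting from all fills $0$), then no filler can achieve backlog $k$ within fewer than $c\left(k+\frac{k^3}{\log^2(n/k+2)}\right)$ rounds.
   Context: The negative-fill variable-processor cup game on $n$ cups: real fills $x_1,\dots,x_n$, initially $0$. In each round the filler chooses an integer $1\le p\le n$ and reals $a_i\in[0,1]$ with $\sum_i a_i=p$ and adds $a_i$ to cup $i$; then the emptier chooses $p$ distinct cups and subtracts exactly $1$ from each of their fills (fills may become negative). The backlog is $\max_i x_i$. The greedy emptier empties from the $p$ fullest cups after the filler's move. *)

theory Defs
  imports Complex_Main
begin

text \<open>Cups are indexed by 0..n-1; a fill state is a function nat => real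
  (values at indices >= n are irrelevant).\<close>

definition valid_filler_move :: "nat \<Rightarrow> nat \<Rightarrow> (nat \<Rightarrow> real) \<Rightarrow> bool" where
  "valid_filler_move n p a \<longleftrightarrow>
     1 \<le> p \<and> p \<le> n \<and> (\<forall>i<n. 0 \<le> a i \<and> a i \<le> 1) \<and> (\<Sum>i<n. a i) = real p"

definition greedy_choice :: "nat \<Rightarrow> (nat \<Rightarrow> real) \<Rightarrow> nat \<Rightarrow> nat set \<Rightarrow> bool" where
  "greedy_choice n y p S \<longleftrightarrow>
     S \<subseteq> {..<n} \<and> card S = p \<and> (\<forall>i\<in>S. \<forall>j\<in>{..<n} - S. y j \<le> y i)"

definition greedy_round :: "nat \<Rightarrow> (nat \<Rightarrow> real) \<Rightarrow> (nat \<Rightarrow> real) \<Rightarrow> bool" where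
  "greedy_round n x x' \<longleftrightarrow>
     (\<exists>p a S. valid_filler_move n p a \<and> greedy_choice n (\<lambda>i. x i + a i) p S \<and>
        (\<forall>i<n. x' i = x i + a i - (if i \<in> S then 1 else 0)))"

definition greedy_play :: "nat \<Rightarrow> (nat \<Rightarrow> nat \<Rightarrow> real) \<Rightarrow> bool" where
  "greedy_play n xs \<longleftrightarrow> (\<forall>i<n. xs 0 i = 0) \<and> (\<forall>t. greedy_round n (xs t) (xs (Suc t)))"

definition backlog :: "nat \<Rightarrow> (nat \<Rightarrow> real) \<Rightarrow> real" where
  "backlog n x = Max (x ` {..<n})"

end

theory Submission
  imports Defs
begin

text \<open>Let \<open>G(h)\<close> be the total fill above height \<open>h\<close>. If greedy empties the cups above the
  threshold \<open>\<theta>\<close>, then \<open>G(h)\<close> can only grow for \<open>\<theta> - 1 < h < \<theta>\<close>, that is at no more than one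
  integer height per round, and its new value is then at most \<open>(G(h - 1) + G(h + 1) - 1) / 2\<close>.

  Because of the loss \<open>1/2\<close>, a parabola is a barrier: backlog \<open>k\<close> forces \<open>G(m)\<close>, for an
  \<open>m\<close> of order \<open>k\<close>, to have reached order \<open>k\<^sup>2\<close>. As \<open>G(0)\<close> is at most of order \<open>n k\<close>, the total drop of
  \<open>ln G\<close> on \<open>[0, m]\<close> is then \<open>O(ln (n/k + 2))\<close>.

  To bound the time for this, dominate \<open>G\<close> by a profile \<open>M\<close> that starts as a steep geometric
  sequence and is averaged at one height per round. The energy \<open>\<Sum> (M(h) / (M(h) - M(h + 1)))\<^sup>2\<close>,
  which is roughly the sum of the inverse squared logarithmic slopes, grows by at most
  \<open>11/2\<close> per averaging step. By convexity it must have grown by order \<open>m\<^sup>3 / ln\<^sup>2 (n/k + 2)\<close> once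
  the average logarithmic slope on \<open>[0, m]\<close> has dropped to order \<open>ln (n/k + 2) / m\<close>.\<close>

section \<open>Total fill above a height and its change in one greedy round\<close>

definition excess :: "nat \<Rightarrow> (nat \<Rightarrow> real) \<Rightarrow> real \<Rightarrow> real" where
  "excess n x h = (\<Sum>i<n. max 0 (x i - h))"

lemma excess_nonneg: "0 \<le> excess n x h"
  by (simp add: excess_def sum_nonneg)

lemma excess_antimono: "h \<le> h' \<Longrightarrow> excess n x h' \<le> excess n x h"
  unfolding excess_def by (intro sum_mono) auto

lemma le_of_excess_nonpos:
  assumes "excess n x h \<le> 0" "i < n"
  shows "x i \<le> h"
proof -
  have "max 0 (x i - h) \<le> excess n x h"
    unfolding excess_def using assms(2) by (intro member_le_sum) auto
  with assms(1) show ?thesis by simp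
qed

lemma excess_le:
  assumes "\<And>i. i < n \<Longrightarrow> x i \<le> b" "h \<le> b"
  shows "excess n x h \<le> real n * (b - h)"
proof -
  have "excess n x h \<le> (\<Sum>i<n. b - h)"
    unfolding excess_def using assms by (intro sum_mono) auto
  then show ?thesis by simp
qed

text \<open>Exactly as much is poured in as is taken out, so losses on \<open>S\<close> balance
  gains on the other cups. The excess can thus grow only if truncation at \<open>h\<close> hides
  part of a loss while part of a gain shows. Against the second difference of the truncation, one
  such cup on each side leaves slack \<tau> and 1 - \<tau>, together the 1 that is lost.\<close>

lemma excess_step:
  assumes fill: "valid_filler_move n p a"
    and S: "S \<subseteq> {..<n}" "card S = p"
    and x': "\<And>i. i < n \<Longrightarrow> x' i = x i + a i - (if i \<in> S then 1 else 0)"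
    and above: "\<And>i. i \<in> S \<Longrightarrow> \<theta> \<le> x i + a i"
    and below: "\<And>i. i \<in> {..<n} - S \<Longrightarrow> x i + a i \<le> \<theta>"
  shows "excess n x' h \<le> excess n x h \<or>
     (\<theta> - 1 < h \<and> h < \<theta> \<and>
      excess n x' h \<le> (excess n x (h - 1) + excess n x (h + 1) - 1) / 2)"
proof -
  define T where "T = {..<n} - S"
  define \<tau> where "\<tau> = \<theta> - h"
  define e where "e i = (if i \<in> S then 1 - a i else a i)" for i
  define d where "d i = max 0 (x i - (h - 1)) - 2 * max 0 (x i - h) + max 0 (x i - (h + 1))" for i
  \<comment> \<open>A cup of S loses e i and a cup of T gains e i; r i is the part of this change that the
     truncation in the excess suppresses on S, respectively lets through on T.\<close>
  define r where "r i = max 0 (x' i - h) - max 0 (x i - h) + (if i \<in> S then e i else 0)" for i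
  have fin: "finite S" "finite T" and ST: "S \<inter> T = {}" "S \<union> T = {..<n}"
    using S finite_subset by (auto simp: T_def)
  have split: "sum f {..<n} = sum f S + sum f T" for f :: "nat \<Rightarrow> real"
    using sum.union_disjoint[OF fin ST(1), of f] ST(2) by simp
  have a: "0 \<le> a i" "a i \<le> 1" if "i < n" for i
    using fill that by (auto simp: valid_filler_move_def)
  have "(\<Sum>i<n. a i) = real p" using fill by (simp add: valid_filler_move_def)
  then have "sum a S + sum a T = real (card S)" by (simp add: split S)
  moreover have "sum e S = real (card S) - sum a S"
    by (simp add: e_def sum_subtractf)
  moreover have eT: "sum e T = sum a T"
    by (intro sum.cong) (auto simp: e_def T_def)
  ultimately have bal: "sum e S = sum e T" by simp
  have rS: "0 \<le> r i \<and> r i \<le> e i \<and> (0 \<le> \<tau> \<longrightarrow> 2 * r i - e i \<le> d i) \<and>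
      (r i > 0 \<longrightarrow> (0 \<le> \<tau> \<longrightarrow> 2 * r i - e i \<le> d i - \<tau>) \<and> \<tau> < 1)" if "i \<in> S" for i
  proof -
    have "i < n" using that S by auto
    then show ?thesis
      using that a[of i] above[of i] x'[of i]
      by (auto simp: r_def d_def e_def \<tau>_def max_def)
  qed
  have rT: "0 \<le> r i \<and> r i \<le> e i \<and> (\<tau> \<le> 1 \<longrightarrow> 2 * r i - e i \<le> d i) \<and>
      (r i > 0 \<longrightarrow> (\<tau> \<le> 1 \<longrightarrow> 2 * r i - e i \<le> d i - (1 - \<tau>)) \<and> \<tau> > 0)" if "i \<in> T" for i
  proof -
    have "i < n" "i \<notin> S" using that by (auto simp: T_def)
    then show ?thesis
      using that a[of i] below[of i] x'[of i]
      by (auto simp: r_def d_def e_def \<tau>_def max_def)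
  qed
  have "sum r {..<n} = excess n x' h - excess n x h + sum e S"
  proof -
    have "(\<Sum>i<n. if i \<in> S then e i else 0) = sum e S"
      using S(1) by (simp add: sum.If_cases Int_absorb1)
    then show ?thesis by (simp add: r_def excess_def sum.distrib sum_subtractf)
  qed
  then have diff: "excess n x' h - excess n x h = sum r S + sum r T - sum e S"
    by (simp add: split)
  have D: "sum d S + sum d T = excess n x (h - 1) - 2 * excess n x h + excess n x (h + 1)"
    unfolding split[symmetric] by (simp add: d_def excess_def sum.distrib sum_subtractf sum_distrib_left)
  show ?thesis
  \<comment> \<open>If no loss is hidden or no gain shows, \<open>bal\<close> already forbids
    growth.\<close>
  proof (cases "(\<exists>i\<in>S. r i > 0) \<and> (\<exists>j\<in>T. r j > 0)")
    case True
    then obtain i j where i: "i \<in> S" "r i > 0" and j: "j \<in> T" "r j > 0" by auto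
    have \<tau>: "0 < \<tau>" "\<tau> < 1" using rS rT i j by auto
    have "(\<Sum>l\<in>S - {i}. 2 * r l - e l) \<le> sum d (S - {i})" using rS \<tau> by (intro sum_mono) auto
    moreover have "2 * r i - e i \<le> d i - \<tau>" using rS i \<tau> by auto
    ultimately have s1: "(\<Sum>l\<in>S. 2 * r l - e l) \<le> sum d S - \<tau>"
      using i fin by (simp add: sum.remove)
    have "(\<Sum>l\<in>T - {j}. 2 * r l - e l) \<le> sum d (T - {j})" using rT \<tau> by (intro sum_mono) auto
    moreover have "2 * r j - e j \<le> d j - (1 - \<tau>)" using rT j \<tau> by auto
    ultimately have s2: "(\<Sum>l\<in>T. 2 * r l - e l) \<le> sum d T - (1 - \<tau>)"
      using j fin by (simp add: sum.remove)
    have "2 * sum r S + 2 * sum r T - sum e S - sum e T \<le> sum d S + sum d T - 1"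
      using s1 s2 by (simp add: sum_subtractf sum_distrib_left)
    then show ?thesis using diff D bal \<tau> by (auto simp: \<tau>_def)
  next
    case False
    moreover have "sum r S \<le> sum e S" "sum r T \<le> sum e T" using rS rT by (auto intro: sum_mono)
    moreover have "sum r S \<le> 0" if "\<not> (\<exists>i\<in>S. r i > 0)" using that by (intro sum_nonpos) auto
    moreover have "sum r T \<le> 0" if "\<not> (\<exists>i\<in>T. r i > 0)" using that by (intro sum_nonpos) auto
    ultimately show ?thesis using diff bal by auto
  qed
qed

lemma greedy_round_excess:
  assumes "greedy_round n x x'"
  obtains h0 :: int where
    "\<And>h::int. h \<noteq> h0 \<Longrightarrow> excess n x' (of_int h) \<le> excess n x (of_int h)"
    "\<And>h::real. excess n x' h \<le>
       max (excess n x h) ((excess n x (h - 1) + excess n x (h + 1) - 1) / 2)"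
proof -
  obtain p a S where v: "valid_filler_move n p a"
    and g: "greedy_choice n (\<lambda>i. x i + a i) p S"
    and x': "\<And>i. i < n \<Longrightarrow> x' i = x i + a i - (if i \<in> S then 1 else 0)"
    using assms by (auto simp: greedy_round_def)
  have S: "S \<subseteq> {..<n}" "card S = p" using g by (auto simp: greedy_choice_def)
  have fin: "finite S" using S finite_subset by blast
  have ne: "S \<noteq> {}" using v S by (auto simp: valid_filler_move_def)
  \<comment> \<open>Greediness makes the lowest filled level in \<open>S\<close> separate it from
    the other cups.\<close>
  define \<theta> where "\<theta> = Min ((\<lambda>i. x i + a i) ` S)"
  have above: "\<theta> \<le> x i + a i" if "i \<in> S" for i
    using that fin by (simp add: \<theta>_def)
  have "\<theta> \<in> (\<lambda>i. x i + a i) ` S" unfolding \<theta>_def using fin ne by (intro Min_in) auto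
  then have below: "x i + a i \<le> \<theta>" if "i \<in> {..<n} - S" for i
    using g that by (auto simp: greedy_choice_def)
  note step = excess_step[OF v S x' above below]
  show ?thesis
  \<comment> \<open>The only integer that can lie strictly between \<theta> - 1 and
    \<theta>.\<close>
  proof (rule that[of "\<lceil>\<theta>\<rceil> - 1"])
    fix h :: int assume "h \<noteq> \<lceil>\<theta>\<rceil> - 1"
    then show "excess n x' (of_int h) \<le> excess n x (of_int h)"
      using step[of "of_int h"] by linarith
  next
    fix h :: real
    show "excess n x' h \<le> max (excess n x h) ((excess n x (h - 1) + excess n x (h + 1) - 1) / 2)"
      using step[of h] by (auto simp: le_max_iff_disj)
  qed
qed

lemma greedy_round_le:
  assumes "greedy_round n x x'" "i < n"
  shows "x' i \<le> x i + 1"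
  using assms by (fastforce simp: greedy_round_def valid_filler_move_def)

section \<open>Height bounds and the parabolic barrier along a play\<close>

lemma play_le_time:
  assumes "greedy_play n xs" "i < n"
  shows "xs t i \<le> real t"
proof (induction t)
  case 0
  then show ?case using assms by (simp add: greedy_play_def)
next
  case (Suc t)
  have "xs (Suc t) i \<le> xs t i + 1"
    using assms by (intro greedy_round_le) (auto simp: greedy_play_def)
  then show ?case using Suc by simp
qed

lemma play_excess_0:
  assumes "greedy_play n xs" "0 \<le> h"
  shows "excess n (xs 0) h = 0"
  unfolding excess_def using assms by (intro sum.neutral) (auto simp: greedy_play_def)

text \<open>The parabola \<open>(N - j)\<^sup>2 / 2\<close> is a barrier because its second difference is exactly the
  constant 1 lost in each averaging step.\<close>

lemma play_le_of_excess_le: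
  fixes m N :: nat
  assumes play: "greedy_play n xs"
    and le: "\<And>s. s \<le> t \<Longrightarrow> excess n (xs s) (real m) \<le> (real N)\<^sup>2 / 2"
    and i: "i < n"
  shows "xs t i \<le> real (m + N)"
proof -
  have "\<forall>j\<le>N. excess n (xs s) (real (m + j)) \<le> (real (N - j))\<^sup>2 / 2" if "s \<le> t" for s
    using that
  proof (induction s)
    case 0
    then show ?case using play_excess_0[OF play] by simp
  next
    case (Suc s)
    have IH: "excess n (xs s) (real (m + j)) \<le> (real (N - j))\<^sup>2 / 2" if "j \<le> N" for j
      using Suc that by auto
    have round: "greedy_round n (xs s) (xs (Suc s))" using play by (simp add: greedy_play_def)
    show ?case
    proof (intro allI impI)
      fix j assume j: "j \<le> N"
      show "excess n (xs (Suc s)) (real (m + j)) \<le> (real (N - j))\<^sup>2 / 2"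
      proof (cases "j = 0")
        case True
        then show ?thesis using le Suc.prems by simp
      next
        case False
        let ?E = "excess n (xs s)"
        have lo: "?E (real (m + j) - 1) \<le> (real N - real j + 1)\<^sup>2 / 2"
          using IH[of "j - 1"] False j by (simp add: of_nat_diff algebra_simps)
        \<comment> \<open>The right-hand side is the parabola one height up,
          \<open>(real N - real j - 1)\<^sup>2 / 2\<close>. The barrier stops at
          \<open>j = N\<close>, where its value is 0 and monotonicity suffices.\<close>
        have hi: "?E (real (m + j) + 1) \<le> (real N - real j)\<^sup>2 - (real N - real j + 1)\<^sup>2 / 2 + 1"
        proof (cases "j = N")
          case True
          have "?E (real (m + j) + 1) \<le> ?E (real (m + j))" by (intro excess_antimono) simp
          then show ?thesis using IH[of j] True by simp
        next
          case False
          then have "?E (real (m + j) + 1) \<le> (real N - real j - 1)\<^sup>2 / 2"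
            using IH[of "Suc j"] j by (simp add: of_nat_diff algebra_simps)
          then show ?thesis by (simp add: power2_eq_square field_simps)
        qed
        have "excess n (xs (Suc s)) (real (m + j)) \<le>
          max (?E (real (m + j))) ((?E (real (m + j) - 1) + ?E (real (m + j) + 1) - 1) / 2)"
          using greedy_round_excess[OF round] by metis
        also have "\<dots> \<le> (real (N - j))\<^sup>2 / 2"
        proof (rule max.boundedI)
          show "(?E (real (m + j) - 1) + ?E (real (m + j) + 1) - 1) / 2 \<le> (real (N - j))\<^sup>2 / 2"
            using lo hi j by (simp add: of_nat_diff)
        qed (rule IH[OF j])
        finally show ?thesis .
      qed
    qed
  qed
  from this[of t] have "excess n (xs t) (real (m + N)) \<le> 0" by auto
  then show ?thesis using i by (rule le_of_excess_nonpos)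
qed

section \<open>Energy: growth under averaging and lower bounds by tangents\<close>

definition energy :: "(nat \<Rightarrow> real) \<Rightarrow> nat \<Rightarrow> real" where
  "energy M h = (M h / (M h - M (Suc h)))\<^sup>2"

text \<open>\<open>M\<close> is the middle of three consecutive values, \<open>A\<close> the drop
  into it and \<open>B\<close> the drop out of it; after averaging both drops are \<open>E\<close>
  and the middle is \<open>M + E - B\<close>. Scaling by \<open>E\<close> leaves the imbalance
  \<open>u\<close> and the height \<open>z\<close>.\<close>

lemma two_term_energy_averaging:
  fixes M A B :: real
  assumes "0 < B" "B < A" "0 < M"
  defines "E \<equiv> (A + B) / 2"
  shows "((M + A) / E)\<^sup>2 + ((M + E - B) / E)\<^sup>2 \<le> ((M + A) / A)\<^sup>2 + (M / B)\<^sup>2 + 11 / 2"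
proof -
  define g where "g = (A - B) / 2"
  have E: "E > 0" and g: "0 < g" "g < E" and A: "A = E + g" and B: "B = E - g"
    using assms(1-3) by (auto simp: E_def g_def field_simps)
  define u where "u = g / E"
  define z where "z = M / E"
  have u: "0 < u" "u < 1" and z: "0 < z" using E g assms(3) by (auto simp: u_def z_def)
  have gu: "g = u * E" and Mz: "M = z * E" using E by (auto simp: u_def z_def)
  have 1: "(M + A) / E = z + 1 + u" "(M + E - B) / E = z + u"
    using E u unfolding A B gu Mz by (auto simp: field_simps)
  have "A = (1 + u) * E" "B = (1 - u) * E" unfolding A B gu by (auto simp: algebra_simps)
  then have MAB: "(M + A) / A = z / (1 + u) + 1" "M / B = z / (1 - u)"
    using E u unfolding Mz by (auto simp: add_divide_distrib)
  \<comment> \<open>The start of the power series. Its quadratic term will absorb the cross term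
    \<open>6 * (z * u)\<close>, making the bound uniform in \<open>z\<close>.\<close>
  have P: "2 + 6 * u\<^sup>2 \<le> 1 / (1 + u)\<^sup>2 + 1 / (1 - u)\<^sup>2"
  proof -
    have nz: "(1 + u)\<^sup>2 * (1 - u)\<^sup>2 > 0" using u by simp
    have "(2 + 6 * u\<^sup>2) * ((1 + u)\<^sup>2 * (1 - u)\<^sup>2) = 2 + 2 * u\<^sup>2 - 10 * u ^ 4 + 6 * u ^ 6"
      by algebra
    also have "\<dots> \<le> 2 + 2 * u\<^sup>2"
    proof -
      have "u ^ 6 \<le> u ^ 4" using u by (intro power_decreasing) auto
      moreover have "0 \<le> u ^ 4" by simp
      ultimately show ?thesis by linarith
    qed
    also have "\<dots> = (1 - u)\<^sup>2 + (1 + u)\<^sup>2" by algebra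
    finally have "2 + 6 * u\<^sup>2 \<le> ((1 - u)\<^sup>2 + (1 + u)\<^sup>2) / ((1 + u)\<^sup>2 * (1 - u)\<^sup>2)"
      using nz by (simp add: pos_le_divide_eq)
    also have "\<dots> = 1 / (1 + u)\<^sup>2 + 1 / (1 - u)\<^sup>2"
      using u by (simp add: add_divide_distrib)
    finally show ?thesis .
  qed
  have "z\<^sup>2 * (2 + 6 * u\<^sup>2) \<le> z\<^sup>2 * (1 / (1 + u)\<^sup>2 + 1 / (1 - u)\<^sup>2)"
    using P by (intro mult_left_mono) auto
  then have 2: "z\<^sup>2 * (2 + 6 * u\<^sup>2) \<le> (z / (1 + u))\<^sup>2 + (z / (1 - u))\<^sup>2"
    by (simp add: power_divide distrib_left)
  have "1 - u \<le> 1 / (1 + u)" using u by (simp add: field_simps power2_eq_square)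
  then have "z * (1 - u) \<le> z * (1 / (1 + u))" using z by (intro mult_left_mono) auto
  then have 3: "z - z * u \<le> z / (1 + u)" by (simp add: algebra_simps)
  have "u\<^sup>2 \<le> u" using u by (simp add: power2_eq_square mult_left_le)
  then have u2: "u\<^sup>2 \<le> 1" using u by linarith
  have "0 \<le> 6 * (z * u - 1 / 2)\<^sup>2" by simp
  then have 4: "6 * (z * u) - 6 * (z * u)\<^sup>2 \<le> 3 / 2"
    by (simp add: power2_eq_square algebra_simps)
  have "(z + 1 + u)\<^sup>2 + (z + u)\<^sup>2 = z\<^sup>2 * (2 + 6 * u\<^sup>2) + (6 * (z * u) - 6 * (z * u)\<^sup>2)
     + 2 * (z - z * u) + 1 + 2 * u + 2 * u\<^sup>2"
    by (simp add: power2_eq_square algebra_simps)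
  \<comment> \<open>\<open>3 / 2\<close> is the maximum of
    \<open>6 * (z * u) - 6 * (z * u)\<^sup>2\<close> and 4 bounds
    \<open>2 * u + 2 * u\<^sup>2\<close>; these sum to \<open>11 / 2\<close>. The remaining 1 comes
    from squaring \<open>z / (1 + u) + 1\<close>.\<close>
  also have "\<dots> \<le> (z / (1 + u))\<^sup>2 + (z / (1 - u))\<^sup>2 + 3 / 2 + 2 * (z / (1 + u)) + 1 + 4"
  proof -
    have "a + b + 2 * c + 1 + 2 * u + 2 * v \<le> p + q + 3 / 2 + 2 * d + 1 + 4"
      if "a \<le> p + q" "b \<le> 3 / 2" "c \<le> d" "v \<le> 1" for a b c d p q v :: real
      using that u by linarith
    from this[OF 2 4 3 u2] show ?thesis .
  qed
  finally show ?thesis unfolding 1 MAB by (simp add: power2_sum)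
qed

text \<open>Only the terms \<open>j\<close> and \<open>Suc j\<close> change; \<open>gt\<close> says
  that the drop at \<open>j\<close> is the larger one.\<close>

lemma energy_averaging:
  fixes M :: "nat \<Rightarrow> real"
  assumes dec: "\<And>h. M (Suc h) < M h" and pos: "\<And>h. 0 < M h"
    and gt: "M (Suc j) < (M j + M (Suc (Suc j))) / 2" and H: "Suc j < H"
  defines "M' \<equiv> M(Suc j := (M j + M (Suc (Suc j))) / 2)"
  shows "(\<Sum>h<H. energy M' h) \<le> (\<Sum>h<H. energy M h) + 11 / 2"
proof -
  let ?J = "{j, Suc j}"
  have split: "(\<Sum>h<H. f h) = (\<Sum>h\<in>{..<H} - ?J. f h) + (f j + f (Suc j))" for f :: "nat \<Rightarrow> real"
    using sum.subset_diff[of ?J "{..<H}" f] H by simp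
  have same: "(\<Sum>h\<in>{..<H} - ?J. energy M' h) = (\<Sum>h\<in>{..<H} - ?J. energy M h)"
    by (intro sum.cong) (auto simp: energy_def M'_def)
  let ?A = "M j - M (Suc j)" and ?B = "M (Suc j) - M (Suc (Suc j))"
  have "energy M' j = ((M (Suc j) + ?A) / ((?A + ?B) / 2))\<^sup>2"
    "energy M' (Suc j) = ((M (Suc j) + (?A + ?B) / 2 - ?B) / ((?A + ?B) / 2))\<^sup>2"
    "energy M j = ((M (Suc j) + ?A) / ?A)\<^sup>2" "energy M (Suc j) = (M (Suc j) / ?B)\<^sup>2"
    by (simp_all add: energy_def M'_def field_simps)
  moreover have "0 < ?B" "?B < ?A" "0 < M (Suc j)" using dec[of "Suc j"] pos gt by auto
  ultimately have "energy M' j + energy M' (Suc j) \<le> energy M j + energy M (Suc j) + 11 / 2"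
    using two_term_energy_averaging[of ?B ?A "M (Suc j)"] by simp
  then show ?thesis using same by (simp add: split)
qed

text \<open>In terms of the ratio \<open>r\<close> of consecutive values the energy is
  \<open>1 / (1 - r)\<^sup>2\<close>, a convex function of \<open>ln r\<close>; this is its tangent
  at \<open>ln s\<close>.\<close>

lemma energy_tangent:
  fixes M :: "nat \<Rightarrow> real"
  assumes "M (Suc h) < M h" "0 < M (Suc h)" and s: "0 < s" "s < 1"
  shows "1 / (1 - s)\<^sup>2 + 2 * s / (1 - s) ^ 3 * (ln (M (Suc h)) - ln (M h) - ln s) \<le> energy M h"
proof -
  define r where "r = M (Suc h) / M h"
  have r: "0 < r" "r < 1" using assms by (auto simp: r_def)
  have en: "energy M h = 1 / (1 - r)\<^sup>2"
    using assms by (simp add: energy_def r_def power_divide field_simps)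
  have "ln (M (Suc h)) - ln (M h) - ln s = ln (r / s)"
    using assms by (simp add: r_def ln_div ln_mult)
  also have "\<dots> \<le> r / s - 1" using r s by (intro ln_le_minus_one) auto
  finally have "2 * s / (1 - s) ^ 3 * (ln (M (Suc h)) - ln (M h) - ln s) \<le>
      2 * s / (1 - s) ^ 3 * (r / s - 1)"
    using s by (intro mult_left_mono) auto
  also have "\<dots> = 2 * (r - s) / (1 - s) ^ 3" using s by (simp add: field_simps)
  also have "\<dots> \<le> 1 / (1 - r)\<^sup>2 - 1 / (1 - s)\<^sup>2"
  proof -
    define X Y where "X = 1 - r" and "Y = 1 - s"
    have XY: "X > 0" "Y > 0" using r s by (auto simp: X_def Y_def)
    \<comment> \<open>Cleared of denominators, the tangent inequality for
      \<open>1 / X\<^sup>2\<close> at \<open>Y\<close> factors in this way.\<close>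
    have "0 \<le> (Y - X)\<^sup>2 * (Y + 2 * X)" using XY by simp
    then have "2 * (Y - X) * X\<^sup>2 \<le> Y ^ 3 - Y * X\<^sup>2"
      by (simp add: power2_eq_square power3_eq_cube algebra_simps)
    then have "2 * (Y - X) * X\<^sup>2 / (X\<^sup>2 * Y ^ 3) \<le> (Y ^ 3 - Y * X\<^sup>2) / (X\<^sup>2 * Y ^ 3)"
      using XY by (intro divide_right_mono) auto
    then have "2 * (Y - X) / Y ^ 3 \<le> 1 / X\<^sup>2 - 1 / Y\<^sup>2"
      using XY by (simp add: diff_divide_distrib power2_eq_square power3_eq_cube)
    then show ?thesis by (simp add: X_def Y_def)
  qed
  finally show ?thesis using en by simp
qed

text \<open>A common tangent point makes the logarithms telescope, so only the end values matter:
  Jensen's inequality in linear form.\<close>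

lemma sum_energy_tangent:
  fixes M :: "nat \<Rightarrow> real"
  assumes "\<And>h. M (Suc h) < M h" "\<And>h. 0 < M h" and s: "0 < s" "s < 1" and "l \<le> u"
  shows "real (u - l) / (1 - s)\<^sup>2
      + 2 * s / (1 - s) ^ 3 * (ln (M u) - ln (M l) - real (u - l) * ln s)
    \<le> (\<Sum>h=l..<u. energy M h)"
proof -
  have "(\<Sum>h=l..<u. 1 / (1 - s)\<^sup>2 + 2 * s / (1 - s) ^ 3 * (ln (M (Suc h)) - ln (M h) - ln s))
      \<le> (\<Sum>h=l..<u. energy M h)"
    using assms by (intro sum_mono energy_tangent) auto
  moreover have "(\<Sum>h=l..<u. ln (M (Suc h)) - ln (M h)) = ln (M u) - ln (M l)"
    using \<open>l \<le> u\<close> by (rule sum_Suc_diff')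
  ultimately show ?thesis
    unfolding sum.distrib sum_distrib_left[symmetric] sum_subtractf by simp
qed

section \<open>Dominating a play by a profile with a geometric tail\<close>

lemma energy_geometric:
  assumes "0 < Q" "0 < r" "r < 1" "M h = Q * r ^ h" "M (Suc h) = Q * r ^ Suc h"
  shows "energy M h = 1 / (1 - r)\<^sup>2"
proof -
  have "M h - M (Suc h) = M h * (1 - r)" using assms by (simp add: algebra_simps)
  moreover have "M h \<noteq> 0" using assms by simp
  ultimately show ?thesis by (simp add: energy_def power_divide)
qed

text \<open>Each height of the geometric tail costs exactly the budgeted
  \<open>1 / (1 - r)\<^sup>2\<close>, so the cutoff can be raised freely.\<close>

lemma sum_energy_extend:
  assumes Q: "0 < Q" and r: "0 < r" "r < 1" and tail: "\<And>h. H \<le> h \<Longrightarrow> M h = Q * r ^ h"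
    and en: "(\<Sum>h<H. energy M h) \<le> real H / (1 - r)\<^sup>2 + b" and "H \<le> H'"
  shows "(\<Sum>h<H'. energy M h) \<le> real H' / (1 - r)\<^sup>2 + b"
proof -
  have "(\<Sum>h<H'. energy M h) = (\<Sum>h<H. energy M h) + (\<Sum>h=H..<H'. energy M h)"
    using \<open>H \<le> H'\<close> sum.atLeastLessThan_concat[of 0 H H' "energy M"]
    by (simp add: lessThan_atLeast0)
  also have "(\<Sum>h=H..<H'. energy M h) = (\<Sum>h=H..<H'. 1 / (1 - r)\<^sup>2)"
    by (intro sum.cong refl energy_geometric[OF Q r] tail) auto
  also have "\<dots> = (real H' - real H) / (1 - r)\<^sup>2" using \<open>H \<le> H'\<close> by (simp add: of_nat_diff)
  finally show ?thesis using en by (simp add: diff_divide_distrib)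
qed

text \<open>Induction over rounds: \<open>M\<close> is averaged at the critical height whenever that
  raises it, at a cost of \<open>11 / 2\<close>. Height 0 stays at \<open>Q\<close> by
  \<open>cap\<close>, and from \<open>H\<close> on \<open>M\<close> is still the initial geometric
  sequence.\<close>

lemma play_majorant:
  assumes play: "greedy_play n xs" and Q: "0 < Q" and r: "0 < r" "r < 1"
    and cap: "\<And>s. s \<le> t \<Longrightarrow> excess n (xs s) 0 \<le> Q"
    and "s \<le> t"
  shows "\<exists>M H. M 0 = Q \<and> (\<forall>h. 0 < M h) \<and> (\<forall>h. M (Suc h) < M h) \<and>
    (\<forall>h. excess n (xs s) (real h) \<le> M h) \<and> (\<forall>h\<ge>H. M h = Q * r ^ h) \<and>
    (\<Sum>h<H. energy M h) \<le> real H / (1 - r)\<^sup>2 + 11 / 2 * real s"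
  using \<open>s \<le> t\<close>
proof (induction s)
  case 0
  show ?case
    by (rule exI[of _ "\<lambda>h. Q * r ^ h"], rule exI[of _ 0])
      (use play_excess_0[OF play] Q r in auto)
next
  case (Suc s)
  then obtain M H where M0: "M 0 = Q" and pos: "\<And>h. 0 < M h" and dec: "\<And>h. M (Suc h) < M h"
    and dom: "\<And>h. excess n (xs s) (real h) \<le> M h" and tail: "\<And>h. H \<le> h \<Longrightarrow> M h = Q * r ^ h"
    and en: "(\<Sum>h<H. energy M h) \<le> real H / (1 - r)\<^sup>2 + 11 / 2 * real s"
    by (metis Suc_leD)
  have "greedy_round n (xs s) (xs (Suc s))" using play by (simp add: greedy_play_def)
  then obtain h0 :: int where
    out: "\<And>h::int. h \<noteq> h0 \<Longrightarrow> excess n (xs (Suc s)) (of_int h) \<le> excess n (xs s) (of_int h)"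
    and avg: "\<And>h::real. excess n (xs (Suc s)) h \<le> max (excess n (xs s) h)
        ((excess n (xs s) (h - 1) + excess n (xs s) (h + 1) - 1) / 2)"
    by (rule greedy_round_excess) blast
  have out: "excess n (xs (Suc s)) (real h) \<le> M h" if "int h \<noteq> h0" for h
    using out[OF that] dom[of h] by simp
  \<comment> \<open>The loss of 1/2 is given up here; it served the barrier.\<close>
  have avg: "excess n (xs (Suc s)) (real (Suc j)) \<le> max (M (Suc j)) ((M j + M (Suc (Suc j))) / 2)" for j
  proof -
    have "(excess n (xs s) (real (Suc j) - 1) + excess n (xs s) (real (Suc j) + 1) - 1) / 2
        \<le> (M j + M (Suc (Suc j))) / 2"
      using dom[of j] dom[of "Suc (Suc j)"] by (simp add: algebra_simps)
    then show ?thesis using avg[of "real (Suc j)"] dom[of "Suc j"] by linarith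
  qed
  show ?case
  proof (cases "\<exists>j. h0 = int (Suc j) \<and> M (Suc j) < (M j + M (Suc (Suc j))) / 2")
    case False
    have "excess n (xs (Suc s)) (real h) \<le> M h" for h
    proof (cases h)
      case 0
      then show ?thesis using cap[OF Suc.prems] M0 by simp
    next
      case (Suc j)
      then show ?thesis using out[of h] avg[of j] False by (cases "int h = h0") auto
    qed
    moreover have "(\<Sum>h<H. energy M h) \<le> real H / (1 - r)\<^sup>2 + 11 / 2 * real (Suc s)"
      using en by (simp add: field_simps)
    ultimately show ?thesis using M0 pos dec tail
      by (intro exI[of _ M] exI[of _ H]) auto
  next
    case True
    then obtain j where h0: "h0 = int (Suc j)" and gt: "M (Suc j) < (M j + M (Suc (Suc j))) / 2"
      by auto
    define M' where "M' = M(Suc j := (M j + M (Suc (Suc j))) / 2)"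
    \<comment> \<open>Keeps both changed terms below the cutoff and the changed value out of the
      tail.\<close>
    define H' where "H' = max H (Suc (Suc j))"
    have "(\<Sum>h<H'. energy M' h) \<le> (\<Sum>h<H'. energy M h) + 11 / 2"
      unfolding M'_def by (rule energy_averaging[OF dec pos gt]) (simp add: H'_def)
    moreover have "(\<Sum>h<H'. energy M h) \<le> real H' / (1 - r)\<^sup>2 + 11 / 2 * real s"
      by (rule sum_energy_extend[OF Q r tail en]) (auto simp: H'_def)
    ultimately have "(\<Sum>h<H'. energy M' h) \<le> real H' / (1 - r)\<^sup>2 + 11 / 2 * real (Suc s)"
      by (simp add: field_simps)
    moreover have "M' 0 = Q" using M0 by (simp add: M'_def)
    moreover have "\<forall>h. 0 < M' h" using pos by (simp add: M'_def add_pos_pos)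
    moreover have "\<forall>h. M' (Suc h) < M' h"
      using dec less_trans[OF dec[of "Suc j"] dec[of j]] by (auto simp: M'_def)
    moreover have "\<forall>h. excess n (xs (Suc s)) (real h) \<le> M' h"
      using out avg[of j] gt h0 by (auto simp: M'_def)
    moreover have "\<forall>h\<ge>H'. M' h = Q * r ^ h" using tail by (auto simp: M'_def H'_def)
    ultimately show ?thesis by blast
  qed
qed

section \<open>From energy to time\<close>

text \<open>Tangents are taken at logarithmic slope \<mu>/2 on \<open>[0, m)\<close>, where
  \<open>big\<close> makes the profile flat, and at \<mu> on \<open>[m, H)\<close>. Halving the
  slope nearly quadruples the energy per height, which outweighs the steeper tail.\<close>

lemma sum_energy_lower_bound:
  fixes M :: "nat \<Rightarrow> real"
  assumes M0: "M 0 = Q" and pos: "\<And>h. 0 < M h" and dec: "\<And>h. M (Suc h) < M h"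
    and \<mu>: "0 < \<mu>" "\<mu> \<le> 1 / 5"
    and MH: "M H = Q * exp (- \<mu>) ^ H" and "m \<le> H"
    and big: "ln Q - ln (M m) \<le> \<mu> * real m / 2"
  shows "real H / (1 - exp (- \<mu>))\<^sup>2 + 3 / 5 * real m / \<mu>\<^sup>2 \<le> (\<Sum>h<H. energy M h)"
proof -
  define r where "r = exp (- \<mu> / 2)"
  define q where "q = exp (- \<mu>)"
  have qr: "q = r\<^sup>2" by (simp add: q_def r_def power2_eq_square flip: exp_add)
  have lnr: "ln r = - \<mu> / 2" "ln q = - \<mu>" by (simp_all add: r_def q_def)
  have r: "9 / 10 \<le> r" "r < 1" using exp_ge_add_one_self[of "- \<mu> / 2"] \<mu> by (auto simp: r_def)
  have q: "0 < q" "q < 1" using \<mu> by (auto simp: q_def)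
  have Q: "Q > 0" using M0 pos[of 0] by simp
  have lnMH: "ln (M H) = ln Q - real H * \<mu>"
    using Q by (simp add: MH ln_mult ln_realpow)
  have "M m \<le> M 0" by (rule lift_Suc_antimono_le) (simp_all add: less_imp_le dec)
  then have MmQ: "ln (M m) \<le> ln Q" using pos[of m] Q M0 by simp

  have "real m / (1 - r)\<^sup>2 + 2 * r / (1 - r) ^ 3 * (ln (M m) - ln Q + real m * (\<mu> / 2))
      \<le> (\<Sum>h<m. energy M h)"
    using sum_energy_tangent[of M r 0 m, OF dec pos] r lnr M0 by (simp add: lessThan_atLeast0)
  moreover have "0 \<le> 2 * r / (1 - r) ^ 3 * (ln (M m) - ln Q + real m * (\<mu> / 2))"
    using r big by (intro mult_nonneg_nonneg divide_nonneg_nonneg) (auto simp: algebra_simps)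
  ultimately have low: "real m / (1 - r)\<^sup>2 \<le> (\<Sum>h<m. energy M h)" by linarith

  \<comment> \<open>The tail may exceed its slope budget by at most \<open>real m * \<mu>\<close>;
    this prices that at \<open>2 / (1 - q)\<^sup>2\<close> per height below
    \<open>m\<close>.\<close>
  have "1 + \<mu> \<le> 1 / q" using exp_ge_add_one_self[of \<mu>] by (simp add: q_def exp_minus field_simps)
  then have "\<mu> * q \<le> 1 - q" using q by (simp add: field_simps)
  then have "2 / (1 - q) ^ 3 * (q * \<mu>) \<le> 2 / (1 - q) ^ 3 * (1 - q)"
    using q by (intro mult_left_mono) (auto simp: mult.commute)
  also have "\<dots> = 2 / (1 - q)\<^sup>2" using q by (simp add: eval_nat_numeral del: right_diff_distrib_numeral)
  finally have K: "2 * q / (1 - q) ^ 3 * \<mu> \<le> 2 / (1 - q)\<^sup>2" by simp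
  have "real (H - m) / (1 - q)\<^sup>2 + 2 * q / (1 - q) ^ 3 * (ln (M H) - ln (M m) + real (H - m) * \<mu>)
      \<le> (\<Sum>h=m..<H. energy M h)"
    using sum_energy_tangent[of M, OF dec pos q \<open>m \<le> H\<close>] lnr by simp
  moreover have "2 * q / (1 - q) ^ 3 * (- (real m * \<mu>))
      \<le> 2 * q / (1 - q) ^ 3 * (ln (M H) - ln (M m) + real (H - m) * \<mu>)"
    using q MmQ \<open>m \<le> H\<close> lnMH by (intro mult_left_mono) (auto simp: of_nat_diff algebra_simps)
  moreover have "real m * (2 * q / (1 - q) ^ 3 * \<mu>) \<le> real m * (2 / (1 - q)\<^sup>2)"
    by (intro mult_left_mono K) auto
  ultimately have high: "real (H - m) / (1 - q)\<^sup>2 - real m * (2 / (1 - q)\<^sup>2) \<le> (\<Sum>h=m..<H. energy M h)"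
    by (simp add: algebra_simps)

  \<comment> \<open>The 3 is 1 for the baseline on \<open>[0, m)\<close> plus 2 for the tail;
    \<open>r \<ge> 9 / 10\<close> leaves \<open>(19 / 10)\<^sup>2 - 3 > 3 / 5\<close>.\<close>
  have gap: "3 / 5 / \<mu>\<^sup>2 \<le> 1 / (1 - r)\<^sup>2 - 3 / (1 - q)\<^sup>2"
  proof -
    have r2: "(19 / 10)\<^sup>2 \<le> (1 + r)\<^sup>2" using r by (intro power_mono) auto
    have f: "1 - q = (1 - r) * (1 + r)" by (simp add: qr power2_eq_square algebra_simps)
    have "1 - q \<le> \<mu>" using exp_ge_add_one_self[of "- \<mu>"] by (simp add: q_def)
    then have "(1 - q)\<^sup>2 \<le> \<mu>\<^sup>2" using q by (intro power_mono) auto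
    then have "3 / 5 / \<mu>\<^sup>2 \<le> 3 / 5 / (1 - q)\<^sup>2" using q \<mu> by (intro divide_left_mono) auto
    also have "\<dots> \<le> ((1 + r)\<^sup>2 - 3) / (1 - q)\<^sup>2"
      using r2 by (intro divide_right_mono) (auto simp: power2_eq_square)
    also have "\<dots> = 1 / (1 - r)\<^sup>2 - 3 / (1 - q)\<^sup>2"
      using r by (simp add: f diff_divide_distrib power_mult_distrib)
    finally show ?thesis .
  qed
  have "real m * (3 / 5 / \<mu>\<^sup>2) \<le> real m * (1 / (1 - r)\<^sup>2 - 3 / (1 - q)\<^sup>2)"
    by (intro mult_left_mono gap) auto
  moreover have "(\<Sum>h<H. energy M h) = (\<Sum>h<m. energy M h) + (\<Sum>h=m..<H. energy M h)"
    using \<open>m \<le> H\<close> sum.atLeastLessThan_concat[of 0 m H "energy M"]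
    by (simp add: lessThan_atLeast0)
  ultimately show ?thesis using low high \<open>m \<le> H\<close>
    by (simp add: q_def of_nat_diff algebra_simps diff_divide_distrib)
qed

text \<open>The majorant starts with slope \<mu>, while the last hypothesis caps its average slope
  on \<open>[0, m]\<close> at \<mu>/2. The baselines cancel between the two energy bounds.\<close>

lemma play_time_lower_bound:
  assumes play: "greedy_play n xs" and "0 < Q"
    and cap: "\<And>s. s \<le> t \<Longrightarrow> excess n (xs s) 0 \<le> Q"
    and \<mu>: "0 < \<mu>" "\<mu> \<le> 1 / 5"
    and "Q \<le> excess n (xs t) (real m) * exp (\<mu> * real m / 2)"
  shows "6 * real m / \<mu>\<^sup>2 \<le> 55 * real t"
proof -
  define r where "r = exp (- \<mu>)"
  have r: "0 < r" "r < 1" using \<mu> by (auto simp: r_def)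
  obtain M H where M0: "M 0 = Q" and pos: "\<And>h. 0 < M h" and dec: "\<And>h. M (Suc h) < M h"
    and dom: "\<And>h. excess n (xs t) (real h) \<le> M h" and tail: "\<And>h. H \<le> h \<Longrightarrow> M h = Q * r ^ h"
    and en: "(\<Sum>h<H. energy M h) \<le> real H / (1 - r)\<^sup>2 + 11 / 2 * real t"
    using play_majorant[OF play \<open>0 < Q\<close> r cap order.refl] by metis
  define H' where "H' = max H m"
  have "Q \<le> excess n (xs t) (real m) * exp (\<mu> * real m / 2)" by fact
  also have "\<dots> \<le> M m * exp (\<mu> * real m / 2)" by (intro mult_right_mono dom) auto
  finally have "ln Q \<le> ln (M m * exp (\<mu> * real m / 2))" using \<open>0 < Q\<close> pos[of m] by simp
  then have "ln Q - ln (M m) \<le> \<mu> * real m / 2" using pos[of m] by (simp add: ln_mult)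
  then have "real H' / (1 - r)\<^sup>2 + 3 / 5 * real m / \<mu>\<^sup>2 \<le> (\<Sum>h<H'. energy M h)"
    unfolding r_def using tail[of H']
    by (intro sum_energy_lower_bound[OF M0 pos dec \<mu>]) (auto simp: H'_def r_def)
  also have "\<dots> \<le> real H' / (1 - r)\<^sup>2 + 11 / 2 * real t"
    by (rule sum_energy_extend[OF \<open>0 < Q\<close> r tail en]) (auto simp: H'_def)
  finally show ?thesis by simp
qed

lemma play_reach_time_lower_bound:
  assumes play: "greedy_play n xs" and i: "i < n" "k \<le> xs t i"
    and cap: "\<And>s i. s \<le> t \<Longrightarrow> i < n \<Longrightarrow> xs s i \<le> 2 * k"
    and k: "0 < k" "280 * ln (real n / k + 2) \<le> k"
  shows "k ^ 3 / (ln (real n / k + 2))\<^sup>2 \<le> 115000 * real t"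
proof -
  define X where "X = real n / k + 2"
  define L where "L = ln X"
  have X: "2 \<le> X" using k by (simp add: X_def)
  have L: "1 / 2 \<le> L"
  proof -
    have "ln (1 / X) \<le> 1 / X - 1" using X by (intro ln_le_minus_one) auto
    moreover have "1 / X \<le> 1 / 2" using X by (simp add: field_simps)
    moreover have "ln (1 / X) = - L" using X by (simp add: L_def ln_div)
    ultimately show ?thesis by simp
  qed
  have kL: "280 * L \<le> k" using k by (simp add: L_def X_def)
  \<comment> \<open>A barrier of width \<open>m\<close> above height \<open>m\<close> ends at
    \<open>2 * m < k\<close>, so reaching \<open>k\<close> means that its base was exceeded.\<close>
  define m where "m = nat \<lfloor>k / 3\<rfloor>"
  have "real m = of_int \<lfloor>k / 3\<rfloor>" using k by (simp add: m_def)
  then have m: "k / 4 \<le> real m" "real m \<le> k / 3" using kL L by linarith+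
  have "\<exists>s\<le>t. (real m)\<^sup>2 / 2 < excess n (xs s) (real m)"
  proof (rule ccontr)
    assume "\<not> ?thesis"
    then have "xs t i \<le> real (m + m)"
      by (intro play_le_of_excess_le[OF play _ i(1)]) (auto simp: not_less)
    then show False using m i(2) k by simp
  qed
  then obtain s where s: "s \<le> t" "(real m)\<^sup>2 / 2 < excess n (xs s) (real m)" by auto
  \<comment> \<open>Makes \<open>exp (\<mu> * real m / 2)\<close> equal to \<open>X ^ 7\<close>: six
    factors give 64, the seventh \<open>real n / k\<close>. With \<open>m \<ge> k / 4\<close>, the
    factor 280 ensures \<mu> \<le> 1/5.\<close>
  define \<mu> where "\<mu> = 14 * L / real m"
  have mpos: "0 < real m" using m k by linarith
  have \<mu>: "0 < \<mu>" "\<mu> \<le> 1 / 5" using mpos L m kL by (auto simp: \<mu>_def field_simps)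
  have "2 * k * real n \<le> excess n (xs s) (real m) * exp (\<mu> * real m / 2)"
  proof -
    have "exp (\<mu> * real m / 2) = exp (real 7 * ln X)" using mpos by (simp add: \<mu>_def L_def)
    also have "\<dots> = X ^ 7" using X by (simp only: exp_of_nat_mult) simp
    also have "\<dots> = X ^ 6 * X" by (simp flip: power_Suc2)
    finally have "exp (\<mu> * real m / 2) = X ^ 6 * X" .
    moreover have "2 ^ 6 * (real n / k) \<le> X ^ 6 * X"
      using X k by (intro mult_mono power_mono) (auto simp: X_def)
    ultimately have e: "64 * (real n / k) \<le> exp (\<mu> * real m / 2)" by simp
    have "(k / 4)\<^sup>2 \<le> (real m)\<^sup>2" using m k by (intro power_mono) auto
    then have "k\<^sup>2 / 32 \<le> excess n (xs s) (real m)" using s(2) by (simp add: power_divide)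
    then have "k\<^sup>2 / 32 * (64 * (real n / k)) \<le> excess n (xs s) (real m) * exp (\<mu> * real m / 2)"
      using e k by (intro mult_mono excess_nonneg) auto
    then show ?thesis using k by (simp add: power2_eq_square)
  qed
  moreover have "excess n (xs s') 0 \<le> 2 * k * real n" if "s' \<le> s" for s'
    using excess_le[of n "xs s'" "2 * k" 0] cap[of s'] that s(1) k by (simp add: mult_ac)
  moreover have "0 < 2 * k * real n" using k i(1) by simp
  ultimately have "6 * real m / \<mu>\<^sup>2 \<le> 55 * real s"
    by (intro play_time_lower_bound[OF play, where Q = "2 * k * real n"] \<mu>)
  moreover have "6 * real m / \<mu>\<^sup>2 = 6 / 196 * ((real m) ^ 3 / L\<^sup>2)"
    using mpos L by (simp add: \<mu>_def power2_eq_square power3_eq_cube)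
  moreover have "(k / 4) ^ 3 / L\<^sup>2 \<le> (real m) ^ 3 / L\<^sup>2"
    using m k by (intro divide_right_mono power_mono) auto
  \<comment> \<open>\<open>55 * 196 * 64 / 6\<close> is just below 115000.\<close>
  ultimately have "k ^ 3 / L\<^sup>2 \<le> 115000 * real s" by (simp add: power_divide)
  also have "\<dots> \<le> 115000 * real t" using s(1) by simp
  finally show ?thesis by (simp add: L_def X_def)
qed

section \<open>First arrival at height \<open>k\<close> and the two regimes of
  \<open>k\<close>\<close>

theorem theorem6p19:
  fixes C :: real
  assumes "C \<ge> 1"
  shows "\<exists>c::real > 0. \<forall>(n::nat) (k::real) xs.
           1 \<le> k \<and> k \<le> C * real n \<and> greedy_play n xs \<longrightarrow>
           (\<forall>t::nat. real t < c * (k + k ^ 3 / (ln (real n / k + 2)) ^ 2) \<longrightarrow>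
              backlog n (xs t) < k)"
\<comment> \<open>Exceeds neither \<open>1 / (1 + 115000)\<close> nor
  \<open>1 / (1 + 78400)\<close>, the constants of the two regimes.\<close>
proof (intro exI[of _ "1 / 10 ^ 6 :: real"] conjI allI impI)
  fix n :: nat and k :: real and xs and t :: nat
  assume "1 \<le> k \<and> k \<le> C * real n \<and> greedy_play n xs"
  then have k: "1 \<le> k" "k \<le> C * real n" and play: "greedy_play n xs" by auto
  define L where "L = ln (real n / k + 2)"
  assume "real t < 1 / 10 ^ 6 * (k + k ^ 3 / (ln (real n / k + 2))\<^sup>2)"
  then have t: "real t < 1 / 10 ^ 6 * (k + k ^ 3 / L\<^sup>2)" by (simp add: L_def)
  have n: "0 < n" using k by (cases "n = 0") auto
  have "0 \<le> real n / k" using k by simp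
  then have L: "0 < L" unfolding L_def by (intro ln_gt_zero) linarith
  show "backlog n (xs t) < k"
  proof (rule ccontr)
    assume "\<not> backlog n (xs t) < k"
    then have "k \<le> Max (xs t ` {..<n})" by (simp add: backlog_def)
    moreover have "Max (xs t ` {..<n}) \<in> xs t ` {..<n}" using n by (intro Max_in) auto
    ultimately have ex: "\<exists>i<n. k \<le> xs t i" by auto
    \<comment> \<open>Before the first arrival all fills are below \<open>k\<close>, and a round
      adds at most 1 \<le> \<open>k\<close>; hence the cap \<open>2 * k\<close>.\<close>
    define u where "u = (LEAST s. \<exists>i<n. k \<le> xs s i)"
    have "u \<le> t" unfolding u_def using ex by (rule Least_le)
    obtain i where i: "i < n" "k \<le> xs u i"
      using LeastI[of "\<lambda>s. \<exists>i<n. k \<le> xs s i", OF ex] by (auto simp: u_def)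
    have early: "xs s i < k" if "s < u" "i < n" for s i
      using not_less_Least[of s "\<lambda>s. \<exists>i<n. k \<le> xs s i"] that by (auto simp: u_def not_le)
    have "k \<le> real u" using play_le_time[OF play i(1), of u] i(2) by simp
    have cap: "xs s i \<le> 2 * k" if "s \<le> u" "i < n" for s i
    proof (cases s)
      case 0
      then show ?thesis using play that k by (simp add: greedy_play_def)
    next
      case (Suc s')
      have "greedy_round n (xs s') (xs s)" using play Suc by (simp add: greedy_play_def)
      then have "xs s i \<le> xs s' i + 1" using that by (intro greedy_round_le)
      then show ?thesis using early[of s' i] Suc that k by simp
    qed
    show False
    proof (cases "280 * L \<le> k")
      case True
      then have "k ^ 3 / L\<^sup>2 \<le> 115000 * real u"
        unfolding L_def using k by (intro play_reach_time_lower_bound[OF play i cap]) auto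
      then show False using t \<open>k \<le> real u\<close> \<open>u \<le> t\<close> k by simp
    next
      case False
      \<comment> \<open>For \<open>k < 280 * L\<close> the cubic term is at most
        \<open>280\<^sup>2 * k\<close>, so \<open>k \<le> real u\<close> suffices.\<close>
      then have "k\<^sup>2 \<le> (280 * L)\<^sup>2" using k by (intro power_mono) auto
      then have "k * k\<^sup>2 \<le> k * (280 * L)\<^sup>2" using k by (intro mult_left_mono) auto
      then have "k ^ 3 / L\<^sup>2 \<le> 78400 * k"
        using L by (simp add: field_simps power2_eq_square power3_eq_cube)
      then show False using t \<open>k \<le> real u\<close> \<open>u \<le> t\<close> k by simp
    qed
  qed
qed simp

end
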